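(* Let $n\ge1$. The interior of a diagospectrahedron is parametrized by a space satisfying the Associativity Equations. That is, let $\mathcal{D}$ be the space of diagonal positive definite real $n\times n$ matrices, which parametrizes the interiors of diagospectrahedra, with affine coordinates $(x^1,\dots,x^n)$, and let $\Phi$ be the restriction to $\mathcal{D}$ of the potential function $\ln\chi$ of the cone of positive definite symmetric matrices. Put $g_{ij}=\partial_i\partial_j\Phi$. Then $(g_{ij})$ is non-degenerate and, with $(g^{ij})$ its inverse matrix, everywhere on $\mathcal{D}$ $$\forall a,b,c,d:\quad \sum_{e,f}\partial_a\partial_b\partial_e\Phi\; g^{ef}\;\partial_f\partial_c\partial_d\Phi=\sum_{e,f}\partial_f\partial_c\partial_b\Phi\; g^{ef}\;\partial_e\partial_a\partial_d\Phi .$$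
   Context: $\mathscr{S}^n$ is the space of real symmetric $n\times n$ matrices, $\mathscr{S}^n_{\ge0}$ (resp. $\Omega=\mathscr{S}^n_{>0}$) the cone of positive semidefinite (resp. positive definite) ones, with the pairing $\langle A,B\rangle=\mathrm{Tr}(AB)$, for which $\Omega$ is self-dual: $\Omega^*=\Omega$. A spectrahedron is a set $\{x\in\mathbb{R}^m \mid Q(x)\in\mathscr{S}^n_{\ge0}\}$ with $Q(x)=Q_0+\sum_{i=1}^m x_iQ_i$, $Q_i\in\mathscr{S}^n$. A diagospectrahedron is a spectrahedron parametrized by diagonal matrices, i.e. all $Q_i$ are diagonal; its interior corresponds to the points $x$ for which the diagonal matrix $Q(x)$ is positive definite. The characteristic function of $\Omega$ is $\chi(x)=\int_{\Omega^*}\exp\{-\langle x,a^*\rangle\}\,da^*$, where $da^*$ is a translation-invariant volume form, and the potential function of the cone is $\ln\chi$. The coordinates on $\mathcal{D}$ are flat (affine), e.g. the diagonal entries, and $\partial_i=\partial/\partial x^i$. The displayed identities are the Associativity Equations (Witten--Dijkgraaf--Verlinde--Verlinde equations), for the potential $\Phi$ and the Hessian metric $g$. *)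

theory Defs
  imports "HOL-Analysis.Analysis"
begin

section \<open>The cone of positive definite symmetric matrices\<close>

definition sym_mats :: "(real^'n^'n) set" where
  "sym_mats = {A. transpose A = A}"

definition psd_cone :: "(real^'n^'n) set" where
  "psd_cone = {A \<in> sym_mats. \<forall>v. 0 \<le> v \<bullet> (A *v v)}"

definition pd_cone :: "(real^'n^'n) set" where
  "pd_cone = {A \<in> sym_mats. \<forall>v. v \<noteq> 0 \<longrightarrow> 0 < v \<bullet> (A *v v)}"

definition trace_pairing :: "real^'n^'n \<Rightarrow> real^'n^'n \<Rightarrow> real" where
  "trace_pairing A B = trace (A ** B)"

text \<open>The open dual cone of a cone of symmetric matrices, taken inside the space of symmetric
  matrices; with this convention the cone of positive definite matrices is self-dual.\<close>

definition dual_cone :: "(real^'n^'n) set \<Rightarrow> (real^'n^'n) set" where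
  "dual_cone C = {a \<in> sym_mats. \<forall>x \<in> closure C - {0}. 0 < trace_pairing x a}"

definition diag_mats :: "(real^'n^'n) set" where
  "diag_mats = {A. \<forall>i j. i \<noteq> j \<longrightarrow> A $ i $ j = 0}"

definition pd_diag :: "(real^'n^'n) set" where
  "pd_diag = diag_mats \<inter> pd_cone"

section \<open>Spectrahedra\<close>

definition pencil :: "real^'n^'n \<Rightarrow> ('m \<Rightarrow> real^'n^'n) \<Rightarrow> real^'m \<Rightarrow> real^'n^'n" where
  "pencil Q0 Q x = Q0 + (\<Sum>i\<in>UNIV. x $ i *\<^sub>R Q i)"

definition spectrahedron :: "real^'n^'n \<Rightarrow> ('m \<Rightarrow> real^'n^'n) \<Rightarrow> (real^'m) set" where
  "spectrahedron Q0 Q = {x. pencil Q0 Q x \<in> psd_cone}"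

text \<open>For diagonal pencils this is the topological interior of the spectrahedron as soon as it is
  nonempty, see \<open>interior_diagospectrahedron\<close> below. (The one-variable pencil \<open>diag (0, x)\<close>
  shows that the nonemptiness is needed.)\<close>

definition spectrahedron_interior :: "real^'n^'n \<Rightarrow> ('m \<Rightarrow> real^'n^'n) \<Rightarrow> (real^'m) set" where
  "spectrahedron_interior Q0 Q = {x. pencil Q0 Q x \<in> pd_cone}"

definition diagonal_pencil :: "real^'n^'n \<Rightarrow> ('m \<Rightarrow> real^'n^'n) \<Rightarrow> bool" where
  "diagonal_pencil Q0 Q \<longleftrightarrow> Q0 \<in> diag_mats \<and> (\<forall>i. Q i \<in> diag_mats)"

section \<open>Characteristic function and potential\<close>

text \<open>The space of symmetric matrices has the linear coordinates \<open>a\<^sub>i\<^sub>j = a\<^sub>j\<^sub>i\<close>, indexed by the sets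
  \<open>{i, j}\<close> (with \<open>i = j\<close> allowed, so that \<open>{i}\<close> indexes the \<open>i\<close>-th diagonal entry). Up to
  orientation, the translation-invariant volume forms are the constant multiples \<open>c > 0\<close> of the
  product of the \<open>da\<^sub>i\<^sub>j\<close>. The resulting measure lives on the Borel sets of all matrices and is
  concentrated on the symmetric ones.\<close>

definition sym_volume :: "real \<Rightarrow> (real^'n^'n) measure" where
  "sym_volume c = scale_measure (ennreal c)
     (distr (\<Pi>\<^sub>M p\<in>{{i, j} | i j :: 'n. True}. lborel) borel (\<lambda>u. \<chi> i j. u {i, j}))"

definition characteristic_function ::
    "(real^'n^'n) measure \<Rightarrow> (real^'n^'n) set \<Rightarrow> real^'n^'n \<Rightarrow> real" where
  "characteristic_function vol C x = (LINT a:dual_cone C|vol. exp (- trace_pairing x a))"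

definition potential :: "(real^'n^'n) measure \<Rightarrow> (real^'n^'n) set \<Rightarrow> real^'n^'n \<Rightarrow> real" where
  "potential vol C x = ln (characteristic_function vol C x)"

section \<open>Affine coordinates and partial derivatives\<close>

text \<open>\<open>\<phi>\<close> sends the coordinates \<open>(x\<^sup>1, \<dots>, x\<^sup>n)\<close> of a diagonal matrix to that matrix.\<close>

definition affine_coordinates :: "(real^'n \<Rightarrow> real^'n^'n) \<Rightarrow> bool" where
  "affine_coordinates \<phi> \<longleftrightarrow>
     (\<exists>b h. linear h \<and> \<phi> = (\<lambda>x. b + h x)) \<and> bij_betw \<phi> UNIV diag_mats"

definition partial :: "'n \<Rightarrow> (real^'n \<Rightarrow> real) \<Rightarrow> real^'n \<Rightarrow> real" where
  "partial i f x = deriv (\<lambda>t. f (x + t *\<^sub>R axis i 1)) 0"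

definition hessian_metric :: "(real^'n \<Rightarrow> real) \<Rightarrow> real^'n \<Rightarrow> real^'n^'n" where
  "hessian_metric \<Phi> x = (\<chi> i j. partial i (partial j \<Phi>) x)"

definition associativity_equations_at :: "(real^'n \<Rightarrow> real) \<Rightarrow> real^'n \<Rightarrow> bool" where
  "associativity_equations_at \<Phi> x \<longleftrightarrow>
     (let ginv = matrix_inv (hessian_metric \<Phi> x);
          D3 = (\<lambda>i j k. partial i (partial j (partial k \<Phi>)) x)
      in \<forall>a b c d. (\<Sum>e\<in>UNIV. \<Sum>f\<in>UNIV. D3 a b e * ginv $ e $ f * D3 f c d)
                 = (\<Sum>e\<in>UNIV. \<Sum>f\<in>UNIV. D3 f c b * ginv $ e $ f * D3 e a d))"

section \<open>Consistency of the notions\<close>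

lemma affine_coordinates_diagonal_entries:
  "affine_coordinates (\<lambda>x::real^'n. \<chi> i j. if i = j then x $ i else 0)"
proof -
  let ?h = "\<lambda>x::real^'n. (\<chi> i j. if i = j then x $ i else 0) :: real^'n^'n"
  have "linear ?h"
    by (rule linearI) (auto simp: vec_eq_iff)
  moreover have "?h = (\<lambda>x. 0 + ?h x)"
    by simp
  moreover have "bij_betw ?h UNIV diag_mats"
    by (rule bij_betw_byWitness[where f' = "\<lambda>A. \<chi> i. A $ i $ i"])
       (auto simp: diag_mats_def vec_eq_iff)
  ultimately show ?thesis
    unfolding affine_coordinates_def by blast
qed

lemma diag_quadratic_form:
  assumes "A \<in> diag_mats"
  shows "v \<bullet> (A *v v) = (\<Sum>i\<in>UNIV. A $ i $ i * (v $ i)\<^sup>2)"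
proof -
  have "(A *v v) $ i = A $ i $ i * v $ i" for i
  proof -
    have "(A *v v) $ i = (\<Sum>j\<in>UNIV. if j = i then A $ i $ i * v $ i else 0)"
      unfolding matrix_vector_mult_def vec_lambda_beta
      using assms by (intro sum.cong) (auto simp: diag_mats_def)
    then show ?thesis by simp
  qed
  then show ?thesis
    by (auto simp: inner_vec_def power2_eq_square intro!: sum.cong)
qed

lemma diag_quadratic_form_axis:
  assumes "A \<in> diag_mats"
  shows "axis i 1 \<bullet> (A *v axis i 1) = A $ i $ i"
proof -
  have "A $ k $ k * (axis i 1 $ k)\<^sup>2 = (if k = i then A $ i $ i else 0)" for k
    by (auto simp: axis_def)
  then show ?thesis
    by (simp add: diag_quadratic_form[OF assms])
qed

lemma diag_symmetric: "A \<in> diag_mats \<Longrightarrow> A \<in> sym_mats"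
  by (auto simp: diag_mats_def sym_mats_def transpose_def vec_eq_iff) metis

lemma diag_psd_iff:
  assumes "A \<in> diag_mats"
  shows "A \<in> psd_cone \<longleftrightarrow> (\<forall>i. 0 \<le> A $ i $ i)"
proof
  assume "A \<in> psd_cone"
  then have "0 \<le> axis i 1 \<bullet> (A *v axis i 1)" for i
    by (simp add: psd_cone_def)
  then show "\<forall>i. 0 \<le> A $ i $ i"
    by (simp add: diag_quadratic_form_axis[OF assms])
next
  assume "\<forall>i. 0 \<le> A $ i $ i"
  then show "A \<in> psd_cone"
    using diag_symmetric[OF assms]
    by (auto simp: psd_cone_def diag_quadratic_form[OF assms] intro!: sum_nonneg)
qed

lemma diag_pd_iff:
  assumes "A \<in> diag_mats"
  shows "A \<in> pd_cone \<longleftrightarrow> (\<forall>i. 0 < A $ i $ i)"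
proof
  assume "A \<in> pd_cone"
  then have "0 < axis i 1 \<bullet> (A *v axis i 1)" for i
    by (simp add: pd_cone_def axis_eq_0_iff)
  then show "\<forall>i. 0 < A $ i $ i"
    by (simp add: diag_quadratic_form_axis[OF assms])
next
  assume pos: "\<forall>i. 0 < A $ i $ i"
  have "0 < v \<bullet> (A *v v)" if "v \<noteq> 0" for v
  proof -
    obtain k where "v $ k \<noteq> 0"
      using \<open>v \<noteq> 0\<close> by (auto simp: vec_eq_iff)
    then show ?thesis
      unfolding diag_quadratic_form[OF assms]
      using pos by (intro sum_pos2[of _ k]) (auto simp: less_imp_le)
  qed
  then show "A \<in> pd_cone"
    using diag_symmetric[OF assms] by (auto simp: pd_cone_def)
qed

lemma pencil_diagonal:
  assumes "diagonal_pencil Q0 Q"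
  shows "pencil Q0 Q x \<in> diag_mats"
  using assms by (auto simp: diagonal_pencil_def pencil_def diag_mats_def)

theorem interior_diagospectrahedron:
  fixes Q0 :: "real^'n^'n" and Q :: "'m::finite \<Rightarrow> real^'n^'n"
  assumes diag: "diagonal_pencil Q0 Q" and ne: "spectrahedron_interior Q0 Q \<noteq> {}"
  shows "interior (spectrahedron Q0 Q) = spectrahedron_interior Q0 Q"
proof
  note pd = diag_pd_iff[OF pencil_diagonal[OF diag]]
  note psd = diag_psd_iff[OF pencil_diagonal[OF diag]]
  have aff: "pencil Q0 Q (x + t *\<^sub>R (x - y)) $ i $ i
      = pencil Q0 Q x $ i $ i + t * (pencil Q0 Q x $ i $ i - pencil Q0 Q y $ i $ i)" for x y t i
    by (simp add: pencil_def sum_subtractf sum.distrib sum_distrib_left algebra_simps)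
  have "spectrahedron_interior Q0 Q = (\<Inter>i. {x. 0 < pencil Q0 Q x $ i $ i})"
    by (auto simp: spectrahedron_interior_def pd)
  moreover have "open (\<Inter>i. {x. 0 < pencil Q0 Q x $ i $ i})"
    unfolding pencil_def
    by (intro open_INT finite ballI open_Collect_less continuous_intros)
  ultimately have "open (spectrahedron_interior Q0 Q)"
    by simp
  then show "spectrahedron_interior Q0 Q \<subseteq> interior (spectrahedron Q0 Q)"
    by (rule interior_maximal[rotated])
       (auto simp: spectrahedron_interior_def spectrahedron_def pd psd less_imp_le)
  obtain y where y: "\<And>i. 0 < pencil Q0 Q y $ i $ i"
    using ne by (auto simp: spectrahedron_interior_def pd)
  show "interior (spectrahedron Q0 Q) \<subseteq> spectrahedron_interior Q0 Q"
  proof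
    fix x assume x: "x \<in> interior (spectrahedron Q0 Q)"
    have "((\<lambda>t. x + t *\<^sub>R (x - y)) \<longlongrightarrow> x + 0 *\<^sub>R (x - y)) (at_right (0::real))"
      by (intro tendsto_intros)
    then have "\<forall>\<^sub>F t in at_right (0::real). x + t *\<^sub>R (x - y) \<in> interior (spectrahedron Q0 Q)"
      using x by (intro topological_tendstoD[of _ x]) auto
    then have "\<exists>t>0. x + t *\<^sub>R (x - y) \<in> interior (spectrahedron Q0 Q)"
      using eventually_happens[OF eventually_conj[OF _ eventually_at_right_less[of 0]]]
      by (metis (no_types, lifting) trivial_limit_at_right_real)
    then obtain t where t: "t > 0" "x + t *\<^sub>R (x - y) \<in> spectrahedron Q0 Q"
      using interior_subset by blast
    have "0 < pencil Q0 Q x $ i $ i" for i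
    proof (rule ccontr)
      assume "\<not> 0 < pencil Q0 Q x $ i $ i"
      moreover have "0 \<le> pencil Q0 Q x $ i $ i + t * (pencil Q0 Q x $ i $ i - pencil Q0 Q y $ i $ i)"
        using t(2) unfolding spectrahedron_def by (simp add: psd aff)
      moreover have "t * (pencil Q0 Q x $ i $ i - pencil Q0 Q y $ i $ i) < 0"
        using t(1) y[of i] calculation(1) by (simp add: mult_pos_neg)
      ultimately show False by linarith
    qed
    then show "x \<in> spectrahedron_interior Q0 Q"
      by (simp add: spectrahedron_interior_def pd)
  qed
qed

end

theory Submission
  imports Defs
begin

text \<open>
  On diagonal matrices the potential of the cone is explicit. For a diagonal positive definite
  \<open>D\<close> with diagonal entries \<open>d\<^sub>1, \<dots>, d\<^sub>n\<close>, the substitution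
  \<open>a\<^sub>i\<^sub>j = b\<^sub>i\<^sub>j / sqrt (d\<^sub>i d\<^sub>j)\<close> in the integral defining \<open>\<chi> D\<close> maps the dual cone onto itself, turns
  \<open>\<langle>D, a\<rangle>\<close> into \<open>tr b\<close>, and has the constant Jacobian \<open>\<Prod>\<^sub>i d\<^sub>i powr (-(n+1)/2)\<close>, because \<open>d\<^sub>i\<close> occurs in
  the \<open>n - 1\<close> off-diagonal coordinates of row \<open>i\<close> and twice in \<open>a\<^sub>i\<^sub>i\<close>. Hence
  \<open>\<chi> D = \<chi> 1 * \<Prod>\<^sub>i d\<^sub>i powr (-(n+1)/2)\<close>, and, once \<open>0 < \<chi> 1 < \<infinity>\<close> is known,
  \<open>\<Phi> = const - (n+1)/2 * \<Sum>\<^sub>i ln d\<^sub>i\<close> (\<open>potential_diagonal\<close>).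

  The value \<open>\<chi> 1\<close> is finite because a positive semidefinite matrix has all its entries bounded by
  its trace, so that \<open>exp (- tr a)\<close> is dominated on the dual cone by a product of functions
  \<open>exp (- |a\<^sub>i\<^sub>j| / N)\<close> of the single coordinates. It is positive because the dual cone contains a box
  of diagonally dominant matrices. Without these two facts \<open>\<Phi>\<close> would be the logarithm of a default
  value, hence constant, and the metric would degenerate.

  In affine coordinates the \<open>d\<^sub>m\<close> are the components \<open>l\<^sub>m\<close> of an invertible affine map with linear
  part \<open>H\<close>, so \<open>\<Phi>\<close> is a sum of functions of one variable each, evaluated at the \<open>l\<^sub>m\<close>. Such a
  potential is diagonal after the change of frame \<open>H\<close>: the metric is \<open>\<Sum>\<^sub>m q\<^sub>m H\<^sub>m\<^sub>i H\<^sub>m\<^sub>j\<close>, the third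
  derivatives are \<open>\<Sum>\<^sub>m t\<^sub>m H\<^sub>m\<^sub>a H\<^sub>m\<^sub>b H\<^sub>m\<^sub>c\<close>, and contracting two of the latter with the inverse metric
  gives \<open>\<Sum>\<^sub>m (t\<^sub>m\<^sup>2 / q\<^sub>m) H\<^sub>m\<^sub>a H\<^sub>m\<^sub>b H\<^sub>m\<^sub>c H\<^sub>m\<^sub>d\<close>, which is symmetric in all four indices
  (\<open>log_barrier_associativity\<close>). In other words, the algebra on each tangent space is \<open>\<real>\<^sup>n\<close> with the
  componentwise product.
\<close>

section \<open>Positive semidefinite matrices and the dual cone\<close>

lemma trace_pairing_sum:
  "trace_pairing A B = (\<Sum>i\<in>UNIV. \<Sum>j\<in>UNIV. A $ i $ j * B $ j $ i)"
  by (simp add: trace_pairing_def trace_def matrix_matrix_mult_def)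

lemma quadratic_form_sum:
  fixes A :: "real^'n^'n"
  shows "v \<bullet> (A *v v) = (\<Sum>i\<in>UNIV. \<Sum>j\<in>UNIV. A $ i $ j * (v $ i * v $ j))"
  by (auto simp: inner_vec_def matrix_vector_mult_def sum_distrib_left intro!: sum.cong)

lemma closed_psd_cone: "closed (psd_cone :: (real^'n^'n) set)"
proof -
  have "psd_cone = (\<Inter>i j. {A :: real^'n^'n. A $ j $ i = A $ i $ j}) \<inter>
     (\<Inter>v. {A. 0 \<le> (\<Sum>i\<in>UNIV. \<Sum>j\<in>UNIV. A $ i $ j * (v $ i * v $ j))})"
    by (auto simp: psd_cone_def sym_mats_def transpose_def vec_eq_iff quadratic_form_sum)
  also have "closed \<dots>"
    by (intro closed_Int closed_INT ballI closed_Collect_eq closed_Collect_le continuous_intros)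
  finally show ?thesis .
qed

text \<open>A positive semidefinite \<open>A\<close> is the limit of the positive definite matrices \<open>A + t 1\<close> as \<open>t\<close>
  decreases to \<open>0\<close>.\<close>

lemma closure_pd_cone: "closure pd_cone = (psd_cone :: (real^'n^'n) set)"
proof
  show "closure pd_cone \<subseteq> (psd_cone :: (real^'n^'n) set)"
    by (rule closure_minimal[OF _ closed_psd_cone])
      (auto simp: pd_cone_def psd_cone_def, metis inner_zero_left order_le_less)
  show "psd_cone \<subseteq> closure (pd_cone :: (real^'n^'n) set)"
  proof
    fix A :: "real^'n^'n" assume A: "A \<in> psd_cone"
    have "A + t *\<^sub>R mat 1 \<in> pd_cone" if "t > 0" for t :: real
    proof -
      have "0 < v \<bullet> ((A + t *\<^sub>R mat 1) *v v)" if "v \<noteq> 0" for v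
      proof -
        have "v \<bullet> ((A + t *\<^sub>R mat 1) *v v) = v \<bullet> (A *v v) + t * (v \<bullet> v)"
          by (simp add: matrix_vector_mult_add_rdistrib inner_right_distrib scaleR_matrix_vector_assoc[symmetric])
        moreover have "0 \<le> v \<bullet> (A *v v)"
          using A by (simp add: psd_cone_def)
        ultimately show ?thesis
          using \<open>v \<noteq> 0\<close> \<open>t > 0\<close> by (simp add: add_nonneg_pos)
      qed
      then show ?thesis
        using A by (auto simp: pd_cone_def psd_cone_def sym_mats_def transpose_def vec_eq_iff mat_def)
    qed
    then have "\<forall>\<^sub>F t in at_right (0::real). A + t *\<^sub>R mat 1 \<in> closure pd_cone"
      using eventually_at_right_less[of "0::real"] closure_subset
      by (auto elim!: eventually_mono)
    moreover have "((\<lambda>t. A + t *\<^sub>R mat 1) \<longlongrightarrow> A + 0 *\<^sub>R mat 1) (at_right (0::real))"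
      by (intro tendsto_intros)
    ultimately show "A \<in> closure pd_cone"
      using Lim_in_closed_set[OF closed_closure] trivial_limit_at_right_real by fastforce
  qed
qed

lemma psd_cone_diag_nonneg:
  fixes A :: "real^'n^'n"
  assumes "A \<in> psd_cone"
  shows "0 \<le> A $ i $ i"
proof -
  have "axis i 1 \<bullet> (A *v axis i 1) = A $ i $ i"
    by (simp add: inner_axis' matrix_vector_mul_component inner_axis)
  then show ?thesis
    using assms by (metis (no_types, lifting) psd_cone_def mem_Collect_eq)
qed

text \<open>Testing the quadratic form on \<open>e\<^sub>i + e\<^sub>j\<close> and \<open>e\<^sub>i - e\<^sub>j\<close> bounds \<open>|a\<^sub>i\<^sub>j|\<close> by the mean of \<open>a\<^sub>i\<^sub>i\<close> and
  \<open>a\<^sub>j\<^sub>j\<close>, and no diagonal entry exceeds the trace. This bound controls the integral at infinity,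
  and it shows that a nonzero positive semidefinite matrix has positive trace.\<close>

lemma psd_cone_entry_le_trace:
  fixes A :: "real^'n^'n"
  assumes "A \<in> psd_cone"
  shows "\<bar>A $ i $ j\<bar> \<le> trace A"
proof -
  have A: "A $ j $ i = A $ i $ j" "\<And>v. 0 \<le> v \<bullet> (A *v v)"
    using assms by (auto simp: psd_cone_def sym_mats_def transpose_def vec_eq_iff)
  have eq: "(axis i 1 + s *\<^sub>R axis j 1) \<bullet> (A *v (axis i 1 + s *\<^sub>R axis j 1)) =
      A $ i $ i + 2 * s * A $ i $ j + s\<^sup>2 * A $ j $ j" for s
    by (simp add: inner_add_left matrix_vector_right_distrib inner_axis' matrix_vector_mul_component
      inner_axis inner_add_right A(1) power2_eq_square algebra_simps)
  have "0 \<le> A $ i $ i + 2 * s * A $ i $ j + s\<^sup>2 * A $ j $ j" for s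
    using A(2) eq by metis
  from this[of 1] this[of "-1"] have "\<bar>A $ i $ j\<bar> \<le> (A $ i $ i + A $ j $ j) / 2"
    by auto
  moreover have le: "A $ k $ k \<le> trace A" for k
    unfolding trace_def by (rule member_le_sum) (auto simp: psd_cone_diag_nonneg[OF assms])
  ultimately show ?thesis
    using le[of i] le[of j] by argo
qed

lemma dual_pd_cone:
  "dual_cone pd_cone = {a \<in> sym_mats. \<forall>x\<in>psd_cone - {0 :: real^'n^'n}. 0 < trace_pairing x a}"
  by (simp add: dual_cone_def closure_pd_cone)

text \<open>Pairing \<open>a\<close> with the rank-one matrix \<open>v v\<^sup>T\<close> gives the value of its quadratic form at \<open>v\<close>.\<close>

lemma dual_pd_cone_subset_psd_cone: "dual_cone pd_cone \<subseteq> (psd_cone :: (real^'n^'n) set)"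
proof
  fix a :: "real^'n^'n" assume a: "a \<in> dual_cone pd_cone"
  have "0 \<le> v \<bullet> (a *v v)" for v
  proof (cases "v = 0")
    case False
    define x :: "real^'n^'n" where "x = (\<chi> i j. v $ i * v $ j)"
    obtain k where "v $ k \<noteq> 0"
      using False by (auto simp: vec_eq_iff)
    then have "x $ k $ k \<noteq> 0"
      by (simp add: x_def)
    then have "x \<noteq> 0"
      by auto
    moreover have "w \<bullet> (x *v w) = (v \<bullet> w)\<^sup>2" for w
      by (subst quadratic_form_sum) (simp add: inner_vec_def power2_eq_square sum_product x_def mult_ac)
    then have "x \<in> psd_cone"
      by (simp add: psd_cone_def sym_mats_def transpose_def vec_eq_iff x_def mult.commute)
    ultimately have "0 < trace_pairing x a"
      using a by (simp add: dual_pd_cone)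
    also have "trace_pairing x a = v \<bullet> (a *v v)"
      unfolding quadratic_form_sum trace_pairing_sum
      by (subst sum.swap) (simp add: x_def mult_ac)
    finally show ?thesis by simp
  qed simp
  then show "a \<in> psd_cone"
    using a by (simp add: psd_cone_def dual_pd_cone)
qed

text \<open>In \<open>\<langle>x, a\<rangle>\<close> the diagonal terms contribute at least \<open>tr x\<close>, while each of the fewer than \<open>n\<^sup>2\<close>
  off-diagonal terms is at most \<open>tr x / (2 n\<^sup>2)\<close> in absolute value, since \<open>|x\<^sub>i\<^sub>j| \<le> tr x\<close>. At least half
  of the trace survives.\<close>

lemma dominant_in_dual_pd_cone:
  fixes a :: "real^'n^'n"
  assumes sym: "a \<in> sym_mats" and diag: "\<And>i. 1 \<le> a $ i $ i"
    and off: "\<And>i j. i \<noteq> j \<Longrightarrow> \<bar>a $ i $ j\<bar> \<le> 1 / (2 * (real CARD('n))\<^sup>2)"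
  shows "a \<in> dual_cone pd_cone"
proof -
  have "0 < trace_pairing x a" if x: "x \<in> psd_cone" and "x \<noteq> 0" for x :: "real^'n^'n"
  proof -
    let ?n = "real CARD('n)"
    have "trace x > 0"
    proof (rule ccontr)
      assume "\<not> trace x > 0"
      then have "\<bar>x $ i $ j\<bar> \<le> 0" for i j
        using psd_cone_entry_le_trace[OF x, of i j] by linarith
      then show False
        using \<open>x \<noteq> 0\<close> by (simp add: vec_eq_iff)
    qed
    have "trace x = (\<Sum>i\<in>UNIV. \<Sum>j\<in>UNIV. if i = j then x $ i $ i else 0)"
      by (simp add: trace_def)
    \<comment> \<open>The deduction \<open>tr x / 2\<close> is spread evenly over all \<open>n\<^sup>2\<close> index pairs.\<close>
    also have "\<dots> - trace x / 2 = (\<Sum>i\<in>UNIV. \<Sum>j\<in>UNIV. (if i = j then x $ i $ i else 0) - trace x * (1 / (2 * ?n\<^sup>2)))"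
      by (simp add: sum_subtractf power2_eq_square)
    also have "\<dots> \<le> trace_pairing x a"
      unfolding trace_pairing_sum
    proof (intro sum_mono)
      fix i j
      show "(if i = j then x $ i $ i else 0) - trace x * (1 / (2 * ?n\<^sup>2)) \<le> x $ i $ j * a $ j $ i"
      proof (cases "i = j")
        case True
        have "x $ i $ i * 1 \<le> x $ i $ i * a $ i $ i"
          by (intro mult_left_mono diag psd_cone_diag_nonneg[OF x])
        moreover have "0 \<le> trace x * (1 / (2 * ?n\<^sup>2))"
          using \<open>trace x > 0\<close> by simp
        ultimately show ?thesis
          using True by simp
      next
        case False
        have "\<bar>x $ i $ j * a $ j $ i\<bar> \<le> trace x * (1 / (2 * ?n\<^sup>2))"
          unfolding abs_mult using False \<open>trace x > 0\<close>
          by (intro mult_mono psd_cone_entry_le_trace[OF x] off) auto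
        then show ?thesis
          using False by (simp add: abs_le_iff)
      qed
    qed
    finally show ?thesis
      using \<open>trace x > 0\<close> by linarith
  qed
  then show ?thesis
    using sym by (simp add: dual_pd_cone)
qed

text \<open>The dual cone is cut out by uncountably many strict inequalities. By homogeneity those with \<open>x\<close> in
  the compact set \<open>S\<close> of positive semidefinite matrices of norm one suffice. The matrices violating
  one of them form the projection of a closed set along \<open>S\<close>, hence a closed set.\<close>

lemma borel_dual_pd_cone: "dual_cone pd_cone \<in> sets (borel :: (real^'n^'n) measure)"
proof -
  define S where "S = psd_cone \<inter> sphere (0 :: real^'n^'n) 1"
  define T where "T = {a :: real^'n^'n. \<exists>x. x \<in> S \<and> (x, a) \<in> {(x, a). trace_pairing x a \<le> 0}}"
  have "compact S"
    unfolding S_def by (intro closed_Int_compact closed_psd_cone compact_sphere)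
  moreover have "closed {(x :: real^'n^'n, a). trace_pairing x a \<le> 0}"
    unfolding trace_pairing_sum case_prod_beta by (intro closed_Collect_le continuous_intros)
  ultimately have "closed T"
    unfolding T_def by (rule closed_compact_projection)
  moreover have "closed (sym_mats :: (real^'n^'n) set)"
  proof -
    have "sym_mats = (\<Inter>i j. {A :: real^'n^'n. A $ j $ i = A $ i $ j})"
      by (auto simp: sym_mats_def transpose_def vec_eq_iff)
    also have "closed \<dots>"
      by (intro closed_INT ballI closed_Collect_eq continuous_intros)
    finally show ?thesis .
  qed
  moreover have "dual_cone pd_cone = sym_mats - T"
  proof -
    have "(\<forall>x\<in>psd_cone - {0}. 0 < trace_pairing x a) \<longleftrightarrow> (\<forall>x\<in>S. 0 < trace_pairing x a)"
      for a :: "real^'n^'n"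
    proof
      assume *: "\<forall>x\<in>S. 0 < trace_pairing x a"
      show "\<forall>x\<in>psd_cone - {0}. 0 < trace_pairing x a"
      proof
        fix x :: "real^'n^'n" assume x: "x \<in> psd_cone - {0}"
        let ?y = "(1 / norm x) *\<^sub>R x"
        have "?y \<in> S"
          using x by (auto simp: S_def psd_cone_def sym_mats_def transpose_def vec_eq_iff
              scaleR_matrix_vector_assoc[symmetric])
        then have "0 < trace_pairing ?y a"
          using * by blast
        also have "trace_pairing ?y a = trace_pairing x a / norm x"
          by (simp add: trace_pairing_sum sum_divide_distrib)
        finally show "0 < trace_pairing x a"
          using x by (simp add: zero_less_divide_iff)
      qed
    qed (auto simp: S_def)
    then show ?thesis
      by (auto simp: dual_pd_cone T_def not_le)
  qed
  ultimately show ?thesis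
    by auto
qed

section \<open>Congruence by diagonal matrices\<close>

text \<open>The congruence \<open>S A S\<close> by the diagonal matrix \<open>S\<close> with entries \<open>r i\<close>.\<close>

definition rescale :: "('n \<Rightarrow> real) \<Rightarrow> real^'n^'n \<Rightarrow> real^'n^'n" where
  "rescale r A = (\<chi> i j. r i * r j * A $ i $ j)"

lemma rescale_sym_mats: "A \<in> sym_mats \<Longrightarrow> rescale r A \<in> sym_mats"
  by (simp add: rescale_def sym_mats_def transpose_def vec_eq_iff mult.commute)

lemma rescale_psd_cone:
  assumes "A \<in> psd_cone"
  shows "rescale r A \<in> psd_cone"
proof -
  have "v \<bullet> (rescale r A *v v) = (\<chi> i. r i * v $ i) \<bullet> (A *v (\<chi> i. r i * v $ i))" for v
    by (simp add: quadratic_form_sum rescale_def mult_ac)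
  then show ?thesis
    using assms rescale_sym_mats by (auto simp: psd_cone_def)
qed

lemma trace_pairing_rescale:
  "trace_pairing x (rescale r A) = trace_pairing (rescale r x) A"
  by (simp add: trace_pairing_sum rescale_def mult_ac)

lemma rescale_dual_pd_cone:
  assumes "\<And>i. r i \<noteq> 0" and "A \<in> dual_cone pd_cone"
  shows "rescale r A \<in> dual_cone pd_cone"
proof -
  have "rescale r x \<noteq> 0" if "x \<noteq> 0" for x
    using that assms(1) by (simp add: rescale_def vec_eq_iff)
  then show ?thesis
    using assms(2) rescale_psd_cone rescale_sym_mats
    by (fastforce simp: dual_pd_cone trace_pairing_rescale)
qed

lemma rescale_dual_pd_cone_iff:
  assumes "\<And>i. r i \<noteq> 0"
  shows "rescale r A \<in> dual_cone pd_cone \<longleftrightarrow> A \<in> dual_cone pd_cone"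
proof
  assume "rescale r A \<in> dual_cone pd_cone"
  then have "rescale (\<lambda>i. 1 / r i) (rescale r A) \<in> dual_cone pd_cone"
    using assms by (intro rescale_dual_pd_cone[of "\<lambda>i. 1 / r i" "rescale r A"]) simp_all
  moreover have "rescale (\<lambda>i. 1 / r i) (rescale r A) = A"
    using assms by (simp add: rescale_def vec_eq_iff)
  ultimately show "A \<in> dual_cone pd_cone"
    by simp
qed (rule rescale_dual_pd_cone[OF assms])

section \<open>Auxiliary integrals\<close>

text \<open>Both sides integrate \<open>f\<close> against measures that agree on boxes, where the claim is the
  one-dimensional scaling rule in each factor.\<close>

lemma nn_integral_PiM_lborel_scale:
  fixes c :: "'i \<Rightarrow> real"
  assumes I: "finite I" and c: "\<And>p. p \<in> I \<Longrightarrow> 0 < c p"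
    and f: "f \<in> borel_measurable (Pi\<^sub>M I (\<lambda>_. lborel))"
  shows "(\<integral>\<^sup>+u. f u \<partial>Pi\<^sub>M I (\<lambda>_. lborel)) =
    ennreal (\<Prod>p\<in>I. c p) * (\<integral>\<^sup>+u. f (\<lambda>p\<in>I. c p * u p) \<partial>Pi\<^sub>M I (\<lambda>_. lborel))"
proof -
  interpret product_sigma_finite "\<lambda>_::'i. lborel :: real measure" ..
  let ?P = "Pi\<^sub>M I (\<lambda>_. lborel :: real measure)"
  let ?T = "\<lambda>u. \<lambda>p\<in>I. c p * u p"
  have T[measurable]: "?T \<in> measurable ?P ?P"
    by measurable
  have "scale_measure (ennreal (\<Prod>p\<in>I. c p)) (distr ?P ?P ?T) = ?P"
  proof (rule PiM_eqI[OF I])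
    fix A :: "'i \<Rightarrow> real set" assume A: "\<And>p. p \<in> I \<Longrightarrow> A p \<in> sets lborel"
    have S: "emeasure lborel (A p) = ennreal (c p) * emeasure lborel ((*) (c p) -` A p)" if "p \<in> I" for p
    proof -
      have [measurable]: "A p \<in> sets borel"
        using A[OF that] by simp
      have "emeasure lborel (A p) = emeasure (density (distr lborel borel ((*) (c p))) (\<lambda>_. \<bar>c p\<bar>)) (A p)"
        using c[OF that] by (subst lborel_distr_mult'[of "c p"]) simp_all
      also have "\<dots> = ennreal (c p) * emeasure lborel ((*) (c p) -` A p)"
        using c[OF that] by (simp add: emeasure_density_const emeasure_distr)
      finally show ?thesis .
    qed
    have V: "(*) (c p) -` A p \<in> sets lborel" if "p \<in> I" for p
    proof -
      have "(*) (c p) \<in> measurable lborel lborel"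
        by simp
      from measurable_sets[OF this A[OF that]] show ?thesis
        by simp
    qed
    have "?T -` Pi\<^sub>E I A \<inter> space ?P = Pi\<^sub>E I (\<lambda>p. (*) (c p) -` A p)"
      by (auto simp: space_PiM PiE_iff)
    then have "emeasure (distr ?P ?P ?T) (Pi\<^sub>E I A) = (\<Prod>p\<in>I. emeasure lborel ((*) (c p) -` A p))"
      using A V I by (simp add: emeasure_distr sets_PiM_I_finite emeasure_PiM)
    moreover have "ennreal (\<Prod>p\<in>I. c p) = (\<Prod>p\<in>I. ennreal (c p))"
      using c by (simp add: prod_ennreal less_imp_le)
    ultimately show "emeasure (scale_measure (ennreal (\<Prod>p\<in>I. c p)) (distr ?P ?P ?T)) (Pi\<^sub>E I A) =
        (\<Prod>p\<in>I. emeasure lborel (A p))"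
      by (simp add: S prod.distrib)
  qed simp
  then have "(\<integral>\<^sup>+u. f u \<partial>?P) =
      (\<integral>\<^sup>+u. f u \<partial>scale_measure (ennreal (\<Prod>p\<in>I. c p)) (distr ?P ?P ?T))"
    by simp
  also have "\<dots> = ennreal (\<Prod>p\<in>I. c p) * (\<integral>\<^sup>+u. f (?T u) \<partial>?P)"
    using f by (simp add: nn_integral_scale_measure nn_integral_distr)
  finally show ?thesis .
qed

lemma nn_integral_exp_neg_abs_finite:
  fixes k :: real
  assumes "0 < k"
  shows "(\<integral>\<^sup>+t. ennreal (exp (- k * \<bar>t\<bar>)) \<partial>lborel) < \<infinity>"
proof -
  \<comment> \<open>The integrand is at most the sum of its restriction to \<open>t \<ge> 0\<close> and the mirror image of that.\<close>
  let ?h = "\<lambda>t::real. ennreal (exp (- k * t)) * indicator {0..} t"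
  have "((\<lambda>t. - exp (- k * t) / k) \<longlongrightarrow> 0) at_top"
    using assms by real_asymp
  then have half: "(\<integral>\<^sup>+t. ?h t \<partial>lborel) = 0 - (- exp (- k * 0) / k)"
    using assms by (intro nn_integral_FTC_atLeast) (auto intro!: derivative_eq_intros)
  have "(\<integral>\<^sup>+t. ennreal (exp (- k * \<bar>t\<bar>)) \<partial>lborel) \<le> (\<integral>\<^sup>+t. ?h t + ?h (0 + (-1) * t) \<partial>lborel)"
    by (intro nn_integral_mono) (auto simp: indicator_def)
  also have "\<dots> = (\<integral>\<^sup>+t. ?h t \<partial>lborel) + (\<integral>\<^sup>+t. ?h (0 + (-1) * t) \<partial>lborel)"
    by (intro nn_integral_add) simp_all
  also have "(\<integral>\<^sup>+t. ?h (0 + (-1) * t) \<partial>lborel) = (\<integral>\<^sup>+t. ?h t \<partial>lborel)"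
    using nn_integral_real_affine[of ?h "-1" 0] by simp
  finally show ?thesis
    by (simp only: half) (auto simp: less_top[symmetric] top_unique)
qed

section \<open>The characteristic function on diagonal matrices\<close>

definition entry_positions :: "'n set set" where
  "entry_positions = {{i, j} | i j :: 'n. True}"

lemma finite_entry_positions [simp]: "finite (entry_positions :: 'n::finite set set)"
  by simp

lemma pair_in_entry_positions [simp]: "{i, j} \<in> entry_positions"
  by (auto simp: entry_positions_def)

lemma singleton_in_entry_positions [simp]: "{i} \<in> entry_positions"
  using pair_in_entry_positions[of i i] by simp

lemma entry_positionsE:
  assumes "p \<in> entry_positions"
  obtains i j where "p = {i, j}"
  using assms by (auto simp: entry_positions_def)

abbreviation entry_space :: "('n::finite set \<Rightarrow> real) measure" where
  "entry_space \<equiv> \<Pi>\<^sub>M p\<in>entry_positions. lborel"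

definition sym_matrix :: "('n set \<Rightarrow> real) \<Rightarrow> real^'n^'n" where
  "sym_matrix u = (\<chi> i j. u {i, j})"

lemma sym_matrix_in_sym_mats: "sym_matrix u \<in> sym_mats"
  by (simp add: sym_matrix_def sym_mats_def transpose_def vec_eq_iff insert_commute)

lemma measurable_sym_matrix [measurable]:
  "sym_matrix \<in> borel_measurable (entry_space :: ('n::finite set \<Rightarrow> real) measure)"
proof (subst borel_measurable_euclidean_space, rule ballI)
  fix B :: "real^'n^'n" assume "B \<in> Basis"
  then obtain i j where B: "B = axis i (axis j 1)"
    by (auto simp: Basis_vec_def)
  have "(\<lambda>u. u {i, j}) \<in> borel_measurable entry_space"
    by (intro measurable_component_singleton[THEN measurable_compose]) auto
  then show "(\<lambda>u. sym_matrix u \<bullet> B) \<in> borel_measurable entry_space"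
    by (simp add: B inner_axis sym_matrix_def)
qed

text \<open>The characteristic function for the unnormalised volume, as an extended nonnegative integral over
  the linear coordinates: in this form the change of variables holds before finiteness is known.\<close>

definition laplace_integral :: "real^'n^'n \<Rightarrow> ennreal" where
  "laplace_integral x =
    (\<integral>\<^sup>+u. indicator (dual_cone pd_cone) (sym_matrix u) * ennreal (exp (- trace_pairing x (sym_matrix u)))
      \<partial>entry_space)"

lemma borel_measurable_trace_pairing [measurable]:
  "trace_pairing x \<in> borel_measurable borel"
  unfolding trace_pairing_sum
  by (intro borel_measurable_continuous_onI continuous_intros)

lemmas [measurable] = borel_dual_pd_cone

lemma characteristic_function_eq_laplace_integral:
  fixes x :: "real^'n^'n"
  assumes "0 < c"
  shows "characteristic_function (sym_volume c) pd_cone x = c * enn2real (laplace_integral x)"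
proof -
  let ?f = "\<lambda>a. indicator (dual_cone pd_cone) a * exp (- trace_pairing x a)"
  let ?D = "distr entry_space borel sym_matrix :: (real^'n^'n) measure"
  have vol: "sym_volume c = scale_measure (ennreal c) ?D"
    by (simp add: sym_volume_def sym_matrix_def[abs_def] entry_positions_def)
  have f[measurable]: "?f \<in> borel_measurable borel"
    by measurable
  have "characteristic_function (sym_volume c) pd_cone x =
      enn2real (\<integral>\<^sup>+a. ennreal (?f a) \<partial>scale_measure (ennreal c) ?D)"
    unfolding characteristic_function_def set_lebesgue_integral_def vol
    by (subst integral_eq_nn_integral) (auto intro!: AE_I2 simp: measurable_cong_sets[OF sets_scale_measure refl])
  also have "\<dots> = enn2real (ennreal c * (\<integral>\<^sup>+u. ennreal (?f (sym_matrix u)) \<partial>entry_space))"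
    by (subst nn_integral_scale_measure, simp, subst nn_integral_distr) simp_all
  also have "(\<integral>\<^sup>+u. ennreal (?f (sym_matrix u)) \<partial>entry_space) = laplace_integral x"
    unfolding laplace_integral_def
    by (intro nn_integral_cong) (simp add: indicator_def)
  finally show ?thesis
    using assms by (simp add: enn2real_mult)
qed

text \<open>On the dual cone \<open>|u p| \<le> tr a\<close> for each of the \<open>N\<close> coordinates \<open>p\<close>. Averaging these bounds gives
  \<open>exp (- tr a) \<le> \<Prod>\<^sub>p exp (- |u p| / N)\<close>, and the integral of the product factorises.\<close>

lemma laplace_integral_mat_1_finite: "laplace_integral (mat 1 :: real^'n^'n) < \<infinity>"
proof -
  interpret product_sigma_finite "\<lambda>_::'n set. lborel :: real measure" ..
  let ?I = "entry_positions :: 'n set set"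
  let ?N = "real (card ?I)"
  have N: "?N > 0"
    by (simp add: card_gt_0_iff ex_in_conv[symmetric]) (blast intro: singleton_in_entry_positions)
  have "laplace_integral (mat 1 :: real^'n^'n) \<le>
      (\<integral>\<^sup>+u. (\<Prod>p\<in>?I. ennreal (exp (- (1 / ?N) * \<bar>u p\<bar>))) \<partial>entry_space)"
    unfolding laplace_integral_def
  proof (intro nn_integral_mono)
    fix u :: "'n set \<Rightarrow> real"
    have "exp (- trace_pairing (mat 1) (sym_matrix u)) \<le> (\<Prod>p\<in>?I. exp (- (1 / ?N) * \<bar>u p\<bar>))"
      if K: "sym_matrix u \<in> dual_cone pd_cone"
    proof -
      have "sym_matrix u \<in> psd_cone"
        using K dual_pd_cone_subset_psd_cone by auto
      then have "\<bar>u p\<bar> \<le> trace (sym_matrix u)" if "p \<in> ?I" for p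
        using psd_cone_entry_le_trace that by (fastforce simp: sym_matrix_def elim: entry_positionsE)
      then have "(\<Sum>p\<in>?I. \<bar>u p\<bar>) \<le> ?N * trace (sym_matrix u)"
        using sum_bounded_above by (metis (no_types, lifting))
      then have "(\<Sum>p\<in>?I. (1 / ?N) * \<bar>u p\<bar>) \<le> trace (sym_matrix u)"
        unfolding sum_distrib_left[symmetric] using N by (simp add: field_simps)
      then show ?thesis
        by (simp add: exp_sum[symmetric] trace_pairing_def sum_negf)
    qed
    then show "indicator (dual_cone pd_cone) (sym_matrix u) * ennreal (exp (- trace_pairing (mat 1) (sym_matrix u)))
        \<le> (\<Prod>p\<in>?I. ennreal (exp (- (1 / ?N) * \<bar>u p\<bar>)))"
      by (auto simp: indicator_def prod_ennreal intro!: ennreal_leI)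
  qed
  also have "\<dots> = (\<Prod>p\<in>?I. \<integral>\<^sup>+t. ennreal (exp (- (1 / ?N) * \<bar>t\<bar>)) \<partial>lborel)"
    by (rule product_nn_integral_prod) simp_all
  also have "\<dots> < \<infinity>"
    using N nn_integral_exp_neg_abs_finite[of "1 / ?N"]
    by (simp add: less_top[symmetric] ennreal_prod_eq_top power_eq_top_ennreal)
  finally show ?thesis .
qed

text \<open>The box with diagonal entries in \<open>[1, 2]\<close> and sufficiently small off-diagonal entries lies in the
  dual cone, has positive volume, and the integrand is at least \<open>exp (- 2 n)\<close> on it.\<close>

lemma laplace_integral_mat_1_pos: "0 < laplace_integral (mat 1 :: real^'n^'n)"
proof -
  interpret product_sigma_finite "\<lambda>_::'n set. lborel :: real measure" ..
  let ?I = "entry_positions :: 'n set set"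
  let ?d = "1 / (2 * (real CARD('n))\<^sup>2)"
  \<comment> \<open>A position \<open>p = {i, j}\<close> is diagonal exactly when it is a singleton.\<close>
  define A where "A p = (if card p = 1 then {1..2} else {-?d..?d})" for p :: "'n set"
  let ?e = "exp (- (2 * real CARD('n)))"
  have d: "?d > 0"
    by simp
  have "emeasure lborel (A p) > 0" for p
    using d by (simp add: A_def)
  then have "0 < ennreal ?e * (\<Prod>p\<in>?I. emeasure lborel (A p))"
    by (simp add: ennreal_zero_less_mult_iff zero_less_iff_neq_zero)
  also have "\<dots> = ennreal ?e * emeasure entry_space (Pi\<^sub>E ?I A)"
    by (subst emeasure_PiM) (auto simp: A_def)
  also have "\<dots> = (\<integral>\<^sup>+u. ennreal ?e * indicator (Pi\<^sub>E ?I A) u \<partial>entry_space)"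
    by (subst nn_integral_cmult_indicator) (auto intro!: sets_PiM_I_finite simp: A_def)
  also have "\<dots> \<le> laplace_integral (mat 1 :: real^'n^'n)"
    unfolding laplace_integral_def
  proof (intro nn_integral_mono)
    fix u :: "'n set \<Rightarrow> real"
    show "ennreal ?e * indicator (Pi\<^sub>E ?I A) u \<le>
        indicator (dual_cone pd_cone) (sym_matrix u) * ennreal (exp (- trace_pairing (mat 1) (sym_matrix u)))"
    proof (cases "u \<in> Pi\<^sub>E ?I A")
      case True
      then have uA: "u {i, j} \<in> A {i, j}" for i j
        by (auto simp: PiE_iff)
      have u: "u {i} \<in> {1..2}" "i \<noteq> j \<Longrightarrow> u {i, j} \<in> {-?d..?d}" for i j
        using uA[of i i] uA[of i j] by (simp_all add: A_def)
      have "sym_matrix u \<in> dual_cone pd_cone"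
        using u by (intro dominant_in_dual_pd_cone sym_matrix_in_sym_mats)
          (simp_all add: sym_matrix_def abs_le_iff minus_le_iff)
      moreover have "trace_pairing (mat 1) (sym_matrix u) \<le> (\<Sum>i\<in>(UNIV :: 'n set). 2)"
        using u unfolding trace_pairing_def matrix_mul_lid trace_def
        by (intro sum_mono) (simp add: sym_matrix_def)
      ultimately show ?thesis
        using True by simp
    qed simp
  qed
  finally show ?thesis .
qed

text \<open>The factor by which \<open>rescale r\<close> multiplies the coordinate at position \<open>p\<close>, namely \<open>r i * r j\<close> for
  \<open>p = {i, j}\<close>. The exponent makes up for \<open>{i, i}\<close> having only one element.\<close>

definition entry_scaling :: "('n \<Rightarrow> real) \<Rightarrow> 'n set \<Rightarrow> real" where
  "entry_scaling r p = (\<Prod>i\<in>p. r i ^ (if card p = 1 then 2 else 1))"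

lemma entry_scaling_pair: "entry_scaling r {i, j} = r i * r j"
  by (cases "i = j") (auto simp: entry_scaling_def power2_eq_square)

text \<open>The Jacobian of \<open>rescale r\<close>. After exchanging the products, the positions containing a fixed \<open>i\<close>
  are \<open>{i, j}\<close> for the \<open>n\<close> values of \<open>j\<close>; each contributes one factor \<open>r i\<close>, and \<open>j = i\<close> contributes
  one more.\<close>

lemma prod_entry_scaling:
  fixes r :: "'n::finite \<Rightarrow> real"
  shows "(\<Prod>p\<in>entry_positions. entry_scaling r p) = (\<Prod>i\<in>UNIV. r i) ^ (CARD('n) + 1)"
proof -
  let ?I = "entry_positions :: 'n set set"
  let ?e = "\<lambda>p. if card p = 1 then 2 else 1 :: nat"
  have "(\<Prod>p\<in>?I. entry_scaling r p) = (\<Prod>p\<in>?I. \<Prod>i | i \<in> UNIV \<and> i \<in> p. r i ^ ?e p)"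
    by (simp add: entry_scaling_def)
  also have "\<dots> = (\<Prod>i\<in>UNIV. \<Prod>p | p \<in> ?I \<and> i \<in> p. r i ^ ?e p)"
    by (rule prod.swap_restrict) simp_all
  also have "\<dots> = (\<Prod>i\<in>UNIV. r i ^ (CARD('n) + 1))"
  proof (rule prod.cong[OF refl])
    fix i :: 'n
    have "(\<Prod>p | p \<in> ?I \<and> i \<in> p. r i ^ ?e p) = (\<Prod>j\<in>UNIV. r i ^ ?e {i, j})"
      by (rule prod.reindex_bij_betw[symmetric])
        (auto simp: bij_betw_def inj_on_def doubleton_eq_iff elim!: entry_positionsE)
    also have "\<dots> = r i ^ (\<Sum>j\<in>UNIV. ?e {i, j})"
      by (simp add: power_sum)
    also have "(\<Sum>j\<in>UNIV. ?e {i, j}) = (\<Sum>j\<in>UNIV. 1 + (if i = j then 1 else 0))"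
      by (rule sum.cong) (auto simp: card_insert_if)
    also have "\<dots> = CARD('n) + 1"
      by (simp only: sum.distrib) simp
    finally show "(\<Prod>p | p \<in> ?I \<and> i \<in> p. r i ^ ?e p) = r i ^ (CARD('n) + 1)" .
  qed
  finally show ?thesis
    by (simp only: prod_power_distrib)
qed

text \<open>The substitution \<open>a = rescale r b\<close>: the dual cone is invariant, and \<open>rescale r\<close> is self-adjoint for
  the trace pairing, so it moves from \<open>a\<close> to \<open>x\<close>.\<close>

lemma laplace_integral_rescale:
  fixes x :: "real^'n^'n"
  assumes r: "\<And>i. 0 < r i"
  shows "laplace_integral x =
    ennreal ((\<Prod>i\<in>UNIV. r i) ^ (CARD('n) + 1)) * laplace_integral (rescale r x)"
proof -
  let ?I = "entry_positions :: 'n set set"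
  let ?f = "\<lambda>u. indicator (dual_cone pd_cone) (sym_matrix u) * ennreal (exp (- trace_pairing x (sym_matrix u)))"
  have "laplace_integral x = ennreal (\<Prod>p\<in>?I. entry_scaling r p) *
      (\<integral>\<^sup>+u. ?f (\<lambda>p\<in>?I. entry_scaling r p * u p) \<partial>entry_space)"
    unfolding laplace_integral_def
    by (rule nn_integral_PiM_lborel_scale) (auto simp: entry_scaling_pair r elim!: entry_positionsE)
  moreover have "sym_matrix (\<lambda>p\<in>?I. entry_scaling r p * u p) = rescale r (sym_matrix u)" for u
    by (auto simp: sym_matrix_def rescale_def vec_eq_iff entry_scaling_pair)
  moreover have "rescale r a \<in> dual_cone pd_cone \<longleftrightarrow> a \<in> dual_cone pd_cone" for a
    using r by (intro rescale_dual_pd_cone_iff) (metis less_irrefl)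
  ultimately show ?thesis
    by (simp add: laplace_integral_def prod_entry_scaling indicator_def trace_pairing_rescale)
qed

text \<open>Rescaling by \<open>r i = 1 / sqrt (D\<^sub>i\<^sub>i)\<close> turns \<open>D\<close> into the identity matrix.\<close>

theorem potential_diagonal:
  fixes c :: real
  assumes "0 < c"
  obtains C where "\<And>D :: real^'n^'n. D \<in> pd_diag \<Longrightarrow> potential (sym_volume c) pd_cone D =
    C - (real CARD('n) + 1) / 2 * (\<Sum>i\<in>UNIV. ln (D $ i $ i))"
proof
  fix D :: "real^'n^'n" assume "D \<in> pd_diag"
  then have diag: "D \<in> diag_mats" and pos: "0 < D $ i $ i" for i
    using diag_pd_iff by (auto simp: pd_diag_def)
  have nz: "D $ i $ i \<noteq> 0" for i
    using pos[of i] by simp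
  define r where "r i = 1 / sqrt (D $ i $ i)" for i
  have r: "0 < r i" for i
    using pos by (simp add: r_def)
  have "rescale r D = mat 1"
    using diag pos by (auto simp: rescale_def vec_eq_iff mat_def diag_mats_def r_def less_imp_le nz)
  then have lap: "laplace_integral D =
      ennreal ((\<Prod>i\<in>UNIV. r i) ^ (CARD('n) + 1)) * laplace_integral (mat 1 :: real^'n^'n)"
    using laplace_integral_rescale[of r D, OF r] by simp
  have L: "0 < enn2real (laplace_integral (mat 1 :: real^'n^'n))"
    using laplace_integral_mat_1_pos laplace_integral_mat_1_finite
    by (simp add: enn2real_positive_iff)
  have P: "0 < (\<Prod>i\<in>UNIV. r i)"
    using r by (simp add: prod_pos)
  have "potential (sym_volume c) pd_cone D =
      ln (c * ((\<Prod>i\<in>UNIV. r i) ^ (CARD('n) + 1) * enn2real (laplace_integral (mat 1 :: real^'n^'n))))"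
    using P by (simp add: potential_def characteristic_function_eq_laplace_integral[OF assms] lap enn2real_mult
        zero_le_mult_iff less_imp_le)
  also have "\<dots> = ln c + ((real CARD('n) + 1) * ln (\<Prod>i\<in>UNIV. r i) +
      ln (enn2real (laplace_integral (mat 1 :: real^'n^'n))))"
    using assms L P by (simp add: ln_mult_pos ln_realpow del: power_Suc prod_zero_iff)
  also have "ln (\<Prod>i\<in>UNIV. r i) = (\<Sum>i\<in>UNIV. ln (r i))"
    by (rule ln_prod) (use r in \<open>simp_all add: less_imp_neq[symmetric]\<close>)
  also have "(\<Sum>i\<in>UNIV. ln (r i)) = - (1 / 2) * (\<Sum>i\<in>UNIV. ln (D $ i $ i))"
    unfolding sum_distrib_left
    using pos by (intro sum.cong) (simp_all add: r_def ln_div ln_sqrt nz less_imp_le)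
  finally show "potential (sym_volume c) pd_cone D =
      (ln c + ln (enn2real (laplace_integral (mat 1 :: real^'n^'n)))) -
      (real CARD('n) + 1) / 2 * (\<Sum>i\<in>UNIV. ln (D $ i $ i))"
    by (simp add: algebra_simps)
qed

section \<open>Associativity for separable potentials\<close>

text \<open>The linear part is injective into the diagonal matrices, hence so is its composition with the map
  reading off the diagonal; an injective endomorphism of \<open>\<real>\<^sup>n\<close> is invertible.\<close>

lemma affine_coordinates_diagonalE:
  fixes \<phi> :: "real^'n \<Rightarrow> real^'n^'n"
  assumes "affine_coordinates \<phi>"
  obtains b :: "'n \<Rightarrow> real" and H :: "real^'n^'n"
  where "invertible H" and "\<And>x m. \<phi> x $ m $ m = b m + (H *v x) $ m"
proof -
  obtain b h where h: "linear h" and \<phi>: "\<And>x. \<phi> x = b + h x" and bij: "bij_betw \<phi> UNIV diag_mats"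
    using assms by (auto simp: affine_coordinates_def)
  define k where "k x = (\<chi> m. h x $ m $ m)" for x
  have k: "linear k"
    using h by (auto simp: k_def vec_eq_iff linear_iff)
  have diag: "h x \<in> diag_mats" for x
  proof -
    have "\<phi> x \<in> diag_mats" "\<phi> 0 \<in> diag_mats"
      using bij by (auto simp: bij_betw_def)
    moreover have "h x = \<phi> x - \<phi> 0"
      by (simp add: \<phi> linear_0[OF h])
    ultimately show ?thesis
      by (simp add: diag_mats_def)
  qed
  have "inj k"
    unfolding linear_injective_0[OF k]
  proof (intro allI impI)
    fix x assume "k x = 0"
    then have "h x = 0"
      using diag[of x] by (auto simp: k_def diag_mats_def vec_eq_iff) metis
    then have "\<phi> x = \<phi> 0"
      by (simp add: \<phi> linear_0[OF h])
    then show "x = 0"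
      using bij by (auto simp: bij_betw_def inj_on_def)
  qed
  moreover have mk: "matrix k *v x = k x" for x
    using k by (simp add: matrix_works linear_matrix_vector_mul_eq)
  ultimately have "invertible (matrix k)"
    unfolding invertible_left_inverse matrix_left_invertible_injective by (simp add: inj_on_def)
  moreover have "\<phi> x $ m $ m = b $ m $ m + (matrix k *v x) $ m" for x m
    by (simp add: mk \<phi> k_def)
  ultimately show ?thesis
    by (rule that)
qed

text \<open>A sum of functions of the single affine forms \<open>b m + (H y) m\<close> has partial derivatives of the same
  shape, with \<open>F\<close> replaced by \<open>F'\<close> and new weights, so this rule can be applied repeatedly. The
  formula for \<open>f\<close> is local because the potential has this form only where all \<open>b m + (H y) m\<close>
  are positive.\<close>

lemma partial_sum_affine:
  fixes H :: "real^'n^'m" and w :: "'m::finite \<Rightarrow> real"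
  assumes "open S" and "x \<in> S"
    and f: "\<And>y. y \<in> S \<Longrightarrow> f y = C + (\<Sum>m\<in>UNIV. w m * F (b m + (H *v y) $ m))"
    and F: "\<And>m. (F has_real_derivative F' (b m + (H *v x) $ m)) (at (b m + (H *v x) $ m))"
  shows "partial i f x = (\<Sum>m\<in>UNIV. w m * H $ m $ i * F' (b m + (H *v x) $ m))"
proof -
  let ?p = "\<lambda>t::real. x + t *\<^sub>R axis i 1"
  let ?g = "\<lambda>t. C + (\<Sum>m\<in>UNIV. w m * F (b m + (H *v x) $ m + t * H $ m $ i))"
  have Hp: "(H *v ?p t) $ m = (H *v x) $ m + t * H $ m $ i" for t m
    by (simp add: matrix_vector_right_distrib matrix_vector_mult_scaleR matrix_vector_mult_basis column_def)
  have "((\<lambda>t. F (b m + (H *v x) $ m + t * H $ m $ i)) has_real_derivative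
      F' (b m + (H *v x) $ m) * H $ m $ i) (at 0)" for m
    by (rule DERIV_chain2[where g = "\<lambda>t. b m + (H *v x) $ m + t * H $ m $ i"])
      (use F in \<open>auto intro!: derivative_eq_intros\<close>)
  then have "(?g has_real_derivative (\<Sum>m\<in>UNIV. w m * H $ m $ i * F' (b m + (H *v x) $ m))) (at 0)"
    by (auto intro!: derivative_eq_intros sum.cong simp: mult_ac)
  moreover have "open (?p -` S)"
    by (intro continuous_open_vimage assms(1)) (auto intro!: continuous_intros)
  ultimately have "((\<lambda>t. f (?p t)) has_real_derivative
      (\<Sum>m\<in>UNIV. w m * H $ m $ i * F' (b m + (H *v x) $ m))) (at 0)"
    by (rule has_field_derivative_transform_within_open)
      (use assms(2) in \<open>simp_all add: f Hp add.assoc\<close>)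
  then show ?thesis
    unfolding partial_def by (rule DERIV_imp_deriv)
qed

definition diag_matrix :: "('n \<Rightarrow> real) \<Rightarrow> real^'n^'n" where
  "diag_matrix q = (\<chi> i j. if i = j then q i else 0)"

lemma diag_matrix_mult: "(diag_matrix q ** A) $ i $ j = q i * A $ i $ j"
  by (simp add: diag_matrix_def matrix_matrix_mult_def if_distrib[of "\<lambda>z. z * _"] cong: if_cong)

lemma invertible_diag_matrix:
  assumes "\<And>i. q i \<noteq> 0"
  shows "invertible (diag_matrix q)"
proof -
  have "diag_matrix q ** diag_matrix (\<lambda>i. 1 / q i) = mat 1"
    using assms by (auto simp: vec_eq_iff diag_matrix_mult mat_def) (auto simp: diag_matrix_def)
  then show ?thesis
    using invertible_right_inverse by blast
qed

text \<open>The metric is \<open>G = H\<^sup>T Q H\<close> with \<open>Q\<close> diagonal, so \<open>H G\<^sup>-\<^sup>1 H\<^sup>T = Q\<^sup>-\<^sup>1\<close>: contracting two covectors with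
  \<open>G\<^sup>-\<^sup>1\<close> divides the products of their components in the frame \<open>H\<close> by the entries of \<open>Q\<close>.\<close>

lemma
  fixes H G :: "real^'n^'n"
  assumes H: "invertible H" and q: "\<And>m. q m \<noteq> 0"
    and G: "\<And>i j. G $ i $ j = (\<Sum>m\<in>UNIV. q m * H $ m $ i * H $ m $ j)"
  shows invertible_diagonalized_metric: "invertible G"
    and contract_inverse_diagonalized_metric:
      "(\<Sum>e\<in>UNIV. \<Sum>f\<in>UNIV. (\<Sum>m\<in>UNIV. \<alpha> m * H $ m $ e) * matrix_inv G $ e $ f *
         (\<Sum>m\<in>UNIV. \<beta> m * H $ m $ f)) = (\<Sum>m\<in>UNIV. \<alpha> m * \<beta> m / q m)"
proof -
  have HT: "invertible (transpose H)"
    using H by (simp add: invertible_det_nz det_transpose)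
  have G': "G = transpose H ** (diag_matrix q ** H)"
  proof -
    have "(transpose H ** B) $ i $ j = (\<Sum>m\<in>UNIV. H $ m $ i * B $ m $ j)" for B :: "real^'n^'n" and i j
      by (simp add: matrix_matrix_mult_def transpose_def)
    then show ?thesis
      by (simp add: vec_eq_iff G diag_matrix_mult mult_ac)
  qed
  show inv: "invertible G"
    unfolding G' by (intro invertible_mult HT invertible_diag_matrix q H)
  let ?M = "H ** (matrix_inv G ** transpose H)"
  obtain L where L: "L ** transpose H = mat 1"
    using HT invertible_left_inverse by blast
  have "transpose H ** (diag_matrix q ** ?M) = (G ** matrix_inv G) ** transpose H"
    by (simp add: G' matrix_mul_assoc)
  also have "\<dots> = transpose H"
    using someI_ex[OF inv[unfolded invertible_def]] by (simp add: matrix_inv_def)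
  finally have "L ** (transpose H ** (diag_matrix q ** ?M)) = L ** transpose H"
    by simp
  then have "diag_matrix q ** ?M = mat 1"
    unfolding matrix_mul_assoc L by (simp add: matrix_mul_assoc)
  then have "q m * ?M $ m $ l = (if m = l then 1 else 0)" for m l
    by (simp add: diag_matrix_mult[symmetric] mat_def)
  then have M: "?M $ m $ l = (if m = l then 1 / q m else 0)" for m l
    using q by (metis mult_cancel_left mult_zero_right nonzero_mult_div_cancel_left times_divide_eq_right)
  let ?a = "transpose H *v (\<chi> m. \<alpha> m)" and ?b = "transpose H *v (\<chi> m. \<beta> m)"
  have pullback: "(\<Sum>m\<in>UNIV. \<gamma> m * H $ m $ e) = (transpose H *v (\<chi> m. \<gamma> m)) $ e" for \<gamma> e
    unfolding matrix_vector_mult_def transpose_def by (simp add: mult.commute)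
  have "(\<Sum>e\<in>UNIV. \<Sum>f\<in>UNIV. (\<Sum>m\<in>UNIV. \<alpha> m * H $ m $ e) * matrix_inv G $ e $ f *
         (\<Sum>m\<in>UNIV. \<beta> m * H $ m $ f)) = (\<Sum>e\<in>UNIV. \<Sum>f\<in>UNIV. ?a $ e * matrix_inv G $ e $ f * ?b $ f)"
    by (simp only: pullback)
  also have "\<dots> = ?a \<bullet> (matrix_inv G *v ?b)"
    by (simp add: inner_vec_def matrix_vector_mult_def[of "matrix_inv G"] sum_distrib_left mult.assoc)
  also have "\<dots> = (\<chi> m. \<alpha> m) \<bullet> (?M *v (\<chi> m. \<beta> m))"
    by (simp only: transpose_matrix_vector[of H "\<chi> m. \<alpha> m"] dot_lmul_matrix matrix_vector_mul_assoc matrix_mul_assoc)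
  also have "\<dots> = (\<Sum>m\<in>UNIV. \<alpha> m * \<beta> m / q m)"
    by (simp add: inner_vec_def matrix_vector_mult_def M if_distrib[of "\<lambda>z. z * _"] cong: if_cong)
  finally show "(\<Sum>e\<in>UNIV. \<Sum>f\<in>UNIV. (\<Sum>m\<in>UNIV. \<alpha> m * H $ m $ e) * matrix_inv G $ e $ f *
         (\<Sum>m\<in>UNIV. \<beta> m * H $ m $ f)) = (\<Sum>m\<in>UNIV. \<alpha> m * \<beta> m / q m)" .
qed

text \<open>With \<open>l\<close> the affine forms, the metric has weights \<open>q\<^sub>m = k / l\<^sub>m\<^sup>2\<close> and the third derivatives have
  weights \<open>t\<^sub>m = - 2 k / l\<^sub>m\<^sup>3\<close>. Both sides of the associativity equations contract to
  \<open>\<Sum>\<^sub>m (t\<^sub>m\<^sup>2 / q\<^sub>m) H\<^sub>m\<^sub>a H\<^sub>m\<^sub>b H\<^sub>m\<^sub>c H\<^sub>m\<^sub>d\<close>.\<close>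

proposition log_barrier_associativity:
  fixes H :: "real^'n^'n" and \<Phi> :: "real^'n \<Rightarrow> real"
  assumes H: "invertible H" and k: "k \<noteq> 0"
    and \<Phi>: "\<And>y. (\<And>m. 0 < b m + (H *v y) $ m) \<Longrightarrow>
      \<Phi> y = C - k * (\<Sum>m\<in>UNIV. ln (b m + (H *v y) $ m))"
    and x: "\<And>m. 0 < b m + (H *v x) $ m"
  shows "invertible (hessian_metric \<Phi> x) \<and> associativity_equations_at \<Phi> x"
proof -
  let ?l = "\<lambda>y m. b m + (H *v y) $ m"
  define S where "S = (\<Inter>m. {y. 0 < ?l y m})"
  have S: "open S"
    unfolding S_def matrix_vector_mult_def vec_lambda_beta
    by (intro open_INT finite ballI open_Collect_less continuous_intros)
  have pos: "0 < ?l y m" if "y \<in> S" for y m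
    using that by (simp add: S_def)
  have "x \<in> S"
    using x by (simp add: S_def)
  have D1: "partial j \<Phi> y = (\<Sum>m\<in>UNIV. - k * H $ m $ j * inverse (?l y m))" if "y \<in> S" for y j
  proof (rule partial_sum_affine[OF S that, where C = C and F = ln and F' = inverse])
    show "\<Phi> y = C + (\<Sum>m\<in>UNIV. - k * ln (?l y m))" if "y \<in> S" for y
      using \<Phi> pos[OF that] by (simp add: sum_distrib_left sum_negf)
    show "(ln has_real_derivative inverse (?l y m)) (at (?l y m))" for m
      using pos[OF that, of m] by (rule DERIV_ln)
  qed
  have D2: "partial i (partial j \<Phi>) y =
      (\<Sum>m\<in>UNIV. - k * H $ m $ j * H $ m $ i * - (1 / (?l y m)\<^sup>2))" if "y \<in> S" for y i j
  proof (rule partial_sum_affine[OF S that, where C = 0 and F = inverse and F' = "\<lambda>z. - (1 / z\<^sup>2)"])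
    show "partial j \<Phi> y = 0 + (\<Sum>m\<in>UNIV. - k * H $ m $ j * inverse (?l y m))" if "y \<in> S" for y
      using D1[OF that] by simp
    show "(inverse has_real_derivative - (1 / (?l y m)\<^sup>2)) (at (?l y m))" for m
      using pos[OF that, of m] by (auto intro!: derivative_eq_intros simp: power2_eq_square field_simps)
  qed
  have D3: "partial h (partial i (partial j \<Phi>)) y =
      (\<Sum>m\<in>UNIV. - k * H $ m $ j * H $ m $ i * H $ m $ h * (2 / (?l y m) ^ 3))" if "y \<in> S" for y h i j
  proof (rule partial_sum_affine[OF S that, where C = 0 and F = "\<lambda>z. - (1 / z\<^sup>2)" and F' = "\<lambda>z. 2 / z ^ 3"])
    show "partial i (partial j \<Phi>) y = 0 + (\<Sum>m\<in>UNIV. - k * H $ m $ j * H $ m $ i * - (1 / (?l y m)\<^sup>2))"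
      if "y \<in> S" for y
      using D2[OF that] by simp
    show "((\<lambda>z. - (1 / z\<^sup>2)) has_real_derivative 2 / (?l y m) ^ 3) (at (?l y m))" for m
    proof -
      have "((\<lambda>z. - (1 / z\<^sup>2)) has_real_derivative 2 / z ^ 3) (at z)" if "0 < z" for z :: real
        using that by (auto intro!: derivative_eq_intros simp: power2_eq_square power3_eq_cube)
      then show ?thesis
        using pos[OF that, of m] by simp
    qed
  qed
  let ?q = "\<lambda>m. k / (?l x m)\<^sup>2" and ?t = "\<lambda>m. - (2 * k) / (?l x m) ^ 3"
  have q: "?q m \<noteq> 0" for m
    using k x[of m] by simp
  have G: "hessian_metric \<Phi> x $ i $ j = (\<Sum>m\<in>UNIV. ?q m * H $ m $ i * H $ m $ j)" for i j
    by (simp add: hessian_metric_def D2[OF \<open>x \<in> S\<close>] mult_ac)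
  \<comment> \<open>The contraction rule needs the contracted index in the last factor: \<open>T\<close> puts the first index
    there, \<open>T'\<close> the last.\<close>
  have T: "partial h (partial i (partial j \<Phi>)) x =
      (\<Sum>m\<in>UNIV. (?t m * H $ m $ i * H $ m $ j) * H $ m $ h)"
    and T': "partial h (partial i (partial j \<Phi>)) x =
      (\<Sum>m\<in>UNIV. (?t m * H $ m $ h * H $ m $ i) * H $ m $ j)" for h i j
    by (auto simp: D3[OF \<open>x \<in> S\<close>] mult_ac intro!: sum.cong)
  note contract = contract_inverse_diagonalized_metric[OF H q G]
  have "(\<Sum>e\<in>UNIV. \<Sum>f\<in>UNIV. partial a (partial b' (partial e \<Phi>)) x * matrix_inv (hessian_metric \<Phi> x) $ e $ f *
        partial f (partial c (partial d \<Phi>)) x) =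
      (\<Sum>e\<in>UNIV. \<Sum>f\<in>UNIV. partial f (partial c (partial b' \<Phi>)) x * matrix_inv (hessian_metric \<Phi> x) $ e $ f *
        partial e (partial a (partial d \<Phi>)) x)" (is "?L = ?R") for a b' c d
  proof -
    have "?L = (\<Sum>m\<in>UNIV. (?t m * H $ m $ a * H $ m $ b') * (?t m * H $ m $ c * H $ m $ d) / ?q m)"
      unfolding T[of _ c d] T'[of a b'] by (rule contract)
    also have "\<dots> = (\<Sum>m\<in>UNIV. (?t m * H $ m $ a * H $ m $ d) * (?t m * H $ m $ c * H $ m $ b') / ?q m)"
      by (simp add: mult_ac)
    also have "\<dots> = (\<Sum>e\<in>UNIV. \<Sum>f\<in>UNIV. partial e (partial a (partial d \<Phi>)) x *
        matrix_inv (hessian_metric \<Phi> x) $ e $ f * partial f (partial c (partial b' \<Phi>)) x)"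
      unfolding T[of _ c b'] T[of _ a d] by (rule contract[symmetric])
    also have "\<dots> = ?R"
      by (simp add: mult_ac)
    finally show ?thesis .
  qed
  moreover have "invertible (hessian_metric \<Phi> x)"
    by (rule invertible_diagonalized_metric[OF H q G])
  ultimately show ?thesis
    unfolding associativity_equations_at_def Let_def by blast
qed

section \<open>The associativity equations on diagonal positive definite matrices\<close>

theorem theorem3:
  fixes c :: real and \<phi> :: "real^'n \<Rightarrow> real^'n^'n"
  assumes "c > 0"
    and "affine_coordinates \<phi>"
  shows "(\<forall>(Q0 :: real^'n^'n) (Q :: 'm::finite \<Rightarrow> real^'n^'n). diagonal_pencil Q0 Q \<longrightarrow>
            spectrahedron_interior Q0 Q = {x. pencil Q0 Q x \<in> pd_diag}) \<and>
         (let \<Phi> = (\<lambda>x. potential (sym_volume c) pd_cone (\<phi> x))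
          in \<forall>x. \<phi> x \<in> pd_diag \<longrightarrow>
               invertible (hessian_metric \<Phi> x) \<and> associativity_equations_at \<Phi> x)"
proof -
  have param: "spectrahedron_interior Q0 Q = {x. pencil Q0 Q x \<in> pd_diag}"
    if "diagonal_pencil Q0 Q" for Q0 :: "real^'n^'n" and Q :: "'m::finite \<Rightarrow> real^'n^'n"
    using pencil_diagonal[OF that] by (auto simp: spectrahedron_interior_def pd_diag_def)
  obtain b :: "'n \<Rightarrow> real" and H :: "real^'n^'n" where H: "invertible H"
    and entries: "\<And>x m. \<phi> x $ m $ m = b m + (H *v x) $ m"
    by (rule affine_coordinates_diagonalE[OF assms(2)]) (rule that)
  obtain C where C: "\<And>D :: real^'n^'n. D \<in> pd_diag \<Longrightarrow> potential (sym_volume c) pd_cone D =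
      C - (real CARD('n) + 1) / 2 * (\<Sum>i\<in>UNIV. ln (D $ i $ i))"
    by (rule potential_diagonal[where 'n = 'n, OF assms(1)]) (rule that)
  have "\<phi> x \<in> diag_mats" for x
    using assms(2) by (auto simp: affine_coordinates_def bij_betw_def)
  then have pd: "\<phi> x \<in> pd_diag \<longleftrightarrow> (\<forall>m. 0 < b m + (H *v x) $ m)" for x
    by (simp add: pd_diag_def diag_pd_iff entries)
  let ?\<Phi> = "\<lambda>x. potential (sym_volume c) pd_cone (\<phi> x)"
  have "invertible (hessian_metric ?\<Phi> x) \<and> associativity_equations_at ?\<Phi> x" if "\<phi> x \<in> pd_diag" for x
  proof (rule log_barrier_associativity[OF H])
    show "(real CARD('n) + 1) / 2 \<noteq> 0"
      by simp
    show "?\<Phi> y = C - (real CARD('n) + 1) / 2 * (\<Sum>m\<in>UNIV. ln (b m + (H *v y) $ m))"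
      if "\<And>m. 0 < b m + (H *v y) $ m" for y
      using that C[of "\<phi> y"] by (simp add: pd entries)
    show "0 < b m + (H *v x) $ m" for m
      using that by (simp add: pd)
  qed
  then show ?thesis
    unfolding Let_def using param by blast
qed

end
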